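(* Let $X$ and $Y$ be locally compact Polish spaces with their Borel $\sigma$-algebras, and let $\mu$ and $\nu$ be finite compactly supported positive Borel measures on $X$ and $Y$ respectively with $\|\mu\|=\|\nu\|$. Then any Markov transfunction $\Phi:\mathcal{M}_\mu\to\mathcal{M}_\nu$ can be approximated by simple Markov transfunctions with respect to weak convergence: there is a sequence $(\Phi_n)_{n\ge1}$ of simple Markov transfunctions $\Phi_n:\mathcal{M}_\mu\to\mathcal{M}_\nu$ such that $\Phi_n\lambda\xrightarrow{w}\Phi\lambda$ for every $\lambda\in\mathcal{M}_\mu$.
   Context: $\|\cdot\|$ is the total variation norm. $\mathcal{M}_\mu$ is the space of all finite signed measures absolutely continuous with respect to $\mu$, i.e. $\mathcal{M}_\mu=\{f\mu:f\in\mathcal{L}^1(X,\mu)\}$, where $f\mu$ is the signed measure $A\mapsto\int_A f\,d\mu$; also $\mathcal{M}^\infty_\nu=\{g\nu:g\in\mathcal{L}^\infty(Y,\nu)\}$, and $\mathcal{M}_\nu$ is defined like $\mathcal{M}_\mu$. A transfunction is a function $\Phi:\mathcal{M}_\mu\to\mathcal{M}_\nu$. It is Markov if it is linear and continuous with respect to total variation, positive ($\lambda\ge0$ implies $\Phi\lambda\ge0$), and measure-preserving ($(\Phi\lambda)(Y)=\lambda(X)$ for all $\lambda$). It is simple if there are $f_1,\dots,f_m\in\mathcal{L}^\infty(X,\mu)$ and $\rho_1,\dots,\rho_m\in\mathcal{M}^\infty_\nu$ with $\Phi\lambda=\sum_{i=1}^m\left(\int_X f_i\,d\lambda\right)\rho_i$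 for all $\lambda$. For a sequence of finite signed measures on $Y$, $\rho_n\xrightarrow{w}\rho$ means $\int_Y g\,d\rho_n\to\int_Y g\,d\rho$ for every bounded continuous $g:Y\to\mathbb{R}$. *)

theory Defs
  imports "HOL-Analysis.Analysis"
begin

text \<open>
  A finite signed Borel measure is represented by its set function, extended by 0 to the
  non-Borel sets, so that equality of set functions is equality of signed measures.  A finite
  positive Borel measure \<open>M\<close> corresponds to the set function \<open>measure M\<close>.
\<close>

type_synonym 'a signed = "'a set \<Rightarrow> real"

definition with_density :: "('a::topological_space \<Rightarrow> real) \<Rightarrow> 'a measure \<Rightarrow> 'a signed" where
  "with_density f M = (\<lambda>A. if A \<in> sets M then (LINT x:A|M. f x) else 0)"

definition L_infinity :: "'a measure \<Rightarrow> ('a \<Rightarrow> real) set" where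
  "L_infinity M = {f \<in> borel_measurable M. \<exists>C. AE x in M. \<bar>f x\<bar> \<le> C}"

definition ac_measures :: "'a::topological_space measure \<Rightarrow> 'a signed set" where
  "ac_measures M = {with_density f M | f. integrable M f}"

definition ac_measures_infinity :: "'a::topological_space measure \<Rightarrow> 'a signed set" where
  "ac_measures_infinity M = {with_density g M | g. g \<in> L_infinity M}"

definition tv_norm :: "'a::topological_space signed \<Rightarrow> ennreal" where
  "tv_norm l = (SUP P \<in> {P. partition_on UNIV P \<and> finite P \<and> P \<subseteq> sets borel}.
     \<Sum>A\<in>P. ennreal \<bar>l A\<bar>)"

text \<open>
  The positive part of the Jordan decomposition; the negative part is the positive part of
  the negated set function.  The supremum includes the empty set, and \<open>ennreal\<close> sends negative
  reals to 0.
\<close>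

definition positive_part :: "'a::topological_space signed \<Rightarrow> 'a measure" where
  "positive_part l = measure_of UNIV (sets borel)
     (\<lambda>A. SUP B \<in> {B \<in> sets borel. B \<subseteq> A}. ennreal (l B))"

definition signed_integral :: "'a::topological_space signed \<Rightarrow> ('a \<Rightarrow> real) \<Rightarrow> real" where
  "signed_integral l g =
     (LINT x|positive_part l. g x) - (LINT x|positive_part (\<lambda>A. - l A). g x)"

definition nonneg_signed :: "'a::topological_space signed \<Rightarrow> bool" where
  "nonneg_signed l \<longleftrightarrow> (\<forall>A\<in>sets borel. 0 \<le> l A)"

definition support :: "'a::topological_space measure \<Rightarrow> 'a set" where
  "support M = {x. \<forall>U. open U \<longrightarrow> x \<in> U \<longrightarrow> emeasure M U > 0}"

text \<open>
  A transfunction is given by a function on all set functions, of which only the values on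
  \<open>ac_measures M\<close> matter.
\<close>

definition transfunction ::
  "'a::topological_space measure \<Rightarrow> 'b::topological_space measure \<Rightarrow> ('a signed \<Rightarrow> 'b signed) \<Rightarrow> bool"
where
  "transfunction M N \<Phi> \<longleftrightarrow> \<Phi> \<in> ac_measures M \<rightarrow> ac_measures N"

definition markov_transfunction ::
  "'a::topological_space measure \<Rightarrow> 'b::topological_space measure \<Rightarrow> ('a signed \<Rightarrow> 'b signed) \<Rightarrow> bool"
where
  "markov_transfunction M N \<Phi> \<longleftrightarrow>
     transfunction M N \<Phi> \<and>
     (\<forall>k\<in>ac_measures M. \<forall>l\<in>ac_measures M. \<Phi> (\<lambda>A. k A + l A) = (\<lambda>B. \<Phi> k B + \<Phi> l B)) \<and>
     (\<forall>c. \<forall>l\<in>ac_measures M. \<Phi> (\<lambda>A. c * l A) = (\<lambda>B. c * \<Phi> l B)) \<and>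
     (\<forall>l\<in>ac_measures M. \<forall>e>0::real. \<exists>d>0::real. \<forall>k\<in>ac_measures M.
        tv_norm (\<lambda>A. k A - l A) < ennreal d \<longrightarrow> tv_norm (\<lambda>B. \<Phi> k B - \<Phi> l B) < ennreal e) \<and>
     (\<forall>l\<in>ac_measures M. nonneg_signed l \<longrightarrow> nonneg_signed (\<Phi> l)) \<and>
     (\<forall>l\<in>ac_measures M. \<Phi> l UNIV = l UNIV)"

definition simple_transfunction ::
  "'a::topological_space measure \<Rightarrow> 'b::topological_space measure \<Rightarrow> ('a signed \<Rightarrow> 'b signed) \<Rightarrow> bool"
where
  "simple_transfunction M N \<Phi> \<longleftrightarrow>
     transfunction M N \<Phi> \<and>
     (\<exists>(m::nat) f \<rho>. (\<forall>i<m. f i \<in> L_infinity M) \<and> (\<forall>i<m. \<rho> i \<in> ac_measures_infinity N) \<and>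
        (\<forall>l\<in>ac_measures M. \<Phi> l = (\<lambda>B. \<Sum>i<m. signed_integral l (f i) * \<rho> i B)))"

definition weakly_converges :: "(nat \<Rightarrow> 'a::topological_space signed) \<Rightarrow> 'a signed \<Rightarrow> bool" where
  "weakly_converges \<rho> r \<longleftrightarrow>
     (\<forall>g. continuous_on UNIV g \<longrightarrow> bounded (range g) \<longrightarrow>
        (\<lambda>n. signed_integral (\<rho> n) g) \<longlonglongrightarrow> signed_integral r g)"

end

theory Submission imports Defs begin

text \<open>
  Only the target space is discretised.  For a finite Borel partition \<open>P\<close> of \<open>Y\<close>, replace \<open>\<Phi> l\<close> on
  each cell \<open>C\<close> by the multiple of \<open>\<nu>\<close> restricted to \<open>C\<close> that has the same mass \<open>\<Phi> l C\<close>.  This averaging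
  contracts the total variation norm and preserves positivity and mass, so the result is again
  Markov.  It is simple because, for fixed \<open>C\<close>, the functional \<open>f \<mapsto> \<Phi> (f\<mu>) C\<close> is linear and lies
  between 0 and \<open>\<integral>f d\<mu>\<close> for \<open>f \<ge> 0\<close>, so by Radon-Nikodym it is integration against a bounded
  function.  If the cells meeting the compact support of \<open>\<nu>\<close> lie in it and have diameter
  at most \<open>e\<close>, integrating \<open>g\<close> against the average differs from integrating \<open>g\<close> against \<open>\<Phi> l\<close> by at
  most the oscillation of \<open>g\<close> at scale \<open>e\<close> times the norm of \<open>\<Phi> l\<close>, and \<open>g\<close> is uniformly continuous
  on the support.
\<close>

section \<open>Measures with an integrable density, as set functions\<close>

lemma space_eq_UNIV:
  assumes "sets M = sets (borel :: 'a::topological_space measure)"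
  shows "space M = UNIV"
  using sets_eq_imp_space_eq[OF assms] by simp

lemma with_density_eq:
  "A \<in> sets M \<Longrightarrow> with_density f M A = (LINT x|M. indicator A x * f x)"
  by (simp add: with_density_def set_lebesgue_integral_def)

lemma integrable_indicator_times:
  fixes f :: "'a \<Rightarrow> real"
  shows "integrable M f \<Longrightarrow> A \<in> sets M \<Longrightarrow> integrable M (\<lambda>x. indicator A x * f x)"
  using integrable_mult_indicator[of A M f] by simp

lemma with_density_add:
  assumes "integrable M f" "integrable M g"
  shows "with_density (\<lambda>x. f x + g x) M = (\<lambda>A. with_density f M A + with_density g M A)"
proof
  fix A
  show "with_density (\<lambda>x. f x + g x) M A = with_density f M A + with_density g M A"
  proof (cases "A \<in> sets M")
    case True
    then show ?thesis
      using assms by (simp add: with_density_eq distrib_left integrable_indicator_times)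
  qed (simp add: with_density_def)
qed

lemma with_density_cmult:
  "with_density (\<lambda>x. c * f x) M = (\<lambda>A. c * with_density f M A)"
  by (auto simp: with_density_def)

lemma with_density_uminus:
  "with_density (\<lambda>x. - f x) M = (\<lambda>A. - with_density f M A)"
  using with_density_cmult[of "-1" f M] by simp

lemma with_density_zero: "with_density (\<lambda>x. 0) M = (\<lambda>A. 0)"
  by (auto simp: with_density_def)

lemma with_density_sum:
  assumes "finite I" "\<And>i. i \<in> I \<Longrightarrow> integrable M (f i)"
  shows "with_density (\<lambda>x. \<Sum>i\<in>I. f i x) M = (\<lambda>A. \<Sum>i\<in>I. with_density (f i) M A)"
  using assms
  by (induction I rule: finite_induct) (simp_all add: with_density_zero with_density_add)

lemma with_density_nonneg:
  "(\<And>x. 0 \<le> f x) \<Longrightarrow> 0 \<le> with_density f M A"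
  by (auto simp: with_density_def set_lebesgue_integral_def intro!: integral_nonneg)

lemma with_density_null:
  assumes "emeasure M A = 0"
  shows "with_density f M A = 0"
proof (cases "A \<in> sets M")
  case True
  then have "A \<in> null_sets M"
    using assms by auto
  then have "AE x in M. indicator A x * f x = 0"
    by (rule AE_I') (auto simp: indicator_def)
  then have "(LINT x|M. indicator A x * f x) = 0"
    by (rule integral_eq_zero_AE)
  then show ?thesis
    using True by (simp add: with_density_eq)
qed (simp add: with_density_def)

lemma with_density_partition:
  assumes M: "sets M = sets borel" and f: "integrable M f"
    and P: "partition_on UNIV P" "finite P" "P \<subseteq> sets borel"
  shows "(\<Sum>C\<in>P. with_density f M C) = with_density f M UNIV"
proof -
  have "(LINT x:(\<Union>C\<in>P. C)|M. f x) = (\<Sum>C\<in>P. LINT x:C|M. f x)"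
    using P M f
    by (intro set_integral_finite_Union)
      (auto simp: disjoint_family_on_def partition_on_def pairwise_def disjnt_def set_integrable_def
        intro!: integrable_indicator_times)
  then show ?thesis
    using P M by (auto simp: with_density_def partition_on_def intro!: sum.cong)
qed

section \<open>Jordan parts, integrals and supports\<close>

text \<open>Among the Borel subsets of \<open>A\<close>, the integral of \<open>f\<close> is largest
  on the part of \<open>A\<close> where \<open>f\<close> is positive, and there it equals the
  integral of \<open>max 0 f\<close> over \<open>A\<close>. So the supremum defining the positive
  part is attained.\<close>

lemma positive_part_with_density:
  fixes f :: "'a::topological_space \<Rightarrow> real"
  assumes M: "sets M = sets borel" and f: "integrable M f"
  shows "positive_part (with_density f M) = density M (\<lambda>x. ennreal (max 0 (f x)))"
proof -
  define D where "D = density M (\<lambda>x. ennreal (max 0 (f x)))"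
  have D: "space D = UNIV" "sets D = sets borel"
    by (simp_all add: D_def M space_eq_UNIV)
  have mf [measurable]: "f \<in> borel_measurable M"
    using f by auto
  have "(SUP B \<in> {B \<in> sets borel. B \<subseteq> A}. ennreal (with_density f M B)) = emeasure D A"
    if A: "A \<in> sets borel" for A
  proof -
    have AM [measurable]: "A \<in> sets M"
      using A M by simp
    have int: "integrable M (\<lambda>x. indicator A x * max 0 (f x))"
      using f by (intro integrable_indicator_times) auto
    have DA: "emeasure D A = ennreal (LINT x|M. indicator A x * max 0 (f x))"
    proof -
      have "emeasure D A = (\<integral>\<^sup>+x. ennreal (indicator A x * max 0 (f x)) \<partial>M)"
        unfolding D_def by (subst emeasure_density) (auto intro!: nn_integral_cong split: split_indicator)
      also have "\<dots> = ennreal (LINT x|M. indicator A x * max 0 (f x))"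
        by (rule nn_integral_eq_integral[OF int]) auto
      finally show ?thesis .
    qed
    show ?thesis
    proof (rule antisym)
      show "(SUP B \<in> {B \<in> sets borel. B \<subseteq> A}. ennreal (with_density f M B)) \<le> emeasure D A"
      proof (rule SUP_least)
        fix B assume "B \<in> {B \<in> sets borel. B \<subseteq> A}"
        then have B: "B \<in> sets M" "B \<subseteq> A"
          using M by auto
        have "(LINT x|M. indicator B x * f x) \<le> (LINT x|M. indicator A x * max 0 (f x))"
          using B int integrable_indicator_times[OF f B(1)]
          by (intro integral_mono) (auto split: split_indicator)
        then show "ennreal (with_density f M B) \<le> emeasure D A"
          by (simp add: DA B with_density_eq ennreal_leI)
      qed
      define B where "B = A \<inter> {x \<in> space M. 0 < f x}"
      have B: "B \<in> sets M"
        unfolding B_def by measurable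
      have "(LINT x|M. indicator B x * f x) = (LINT x|M. indicator A x * max 0 (f x))"
        by (intro Bochner_Integration.integral_cong) (auto simp: B_def split: split_indicator)
      then have "emeasure D A = ennreal (with_density f M B)"
        by (simp add: DA B with_density_eq)
      also have "\<dots> \<le> (SUP B \<in> {B \<in> sets borel. B \<subseteq> A}. ennreal (with_density f M B))"
        using B M by (intro SUP_upper) (auto simp: B_def)
      finally show "emeasure D A \<le> (SUP B \<in> {B \<in> sets borel. B \<subseteq> A}. ennreal (with_density f M B))" .
    qed
  qed
  \<comment> \<open>\<open>measure_of\<close> depends only on the values on the generated
    sigma-algebra, here the Borel sets, and a measure is recovered from its own
    \<open>emeasure\<close>.\<close>
  then have "positive_part (with_density f M) = measure_of UNIV (sets borel) (emeasure D)"
    unfolding positive_part_def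
    by (intro measure_of_eq) (use D sets.sigma_sets_eq[of D] in auto)
  also have "\<dots> = D"
    using measure_of_of_measure[of D] D by simp
  finally show ?thesis
    by (simp add: D_def)
qed

text \<open>The Jordan parts have densities \<open>max 0 f\<close> and \<open>max 0 (- f)\<close>.
  Each of these times \<open>g\<close> is dominated by \<open>f * g\<close> in absolute value, so
  the two integrals are finite and may be subtracted under one integral sign.\<close>

lemma signed_integral_with_density:
  fixes f :: "'a::topological_space \<Rightarrow> real"
  assumes M: "sets M = sets borel" and f: "integrable M f"
    and g: "g \<in> borel_measurable M" and fg: "integrable M (\<lambda>x. f x * g x)"
  shows "signed_integral (with_density f M) g = (LINT x|M. f x * g x)"
proof -
  have [measurable]: "f \<in> borel_measurable M" "g \<in> borel_measurable M"
    using f g by auto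
  have int: "integrable M (\<lambda>x. max 0 (f x) * g x)" "integrable M (\<lambda>x. max 0 (- f x) * g x)"
    by (rule Bochner_Integration.integrable_bound[OF fg]; auto simp: abs_mult intro!: mult_right_mono)+
  have "signed_integral (with_density f M) g =
      (LINT x|M. max 0 (f x) * g x) - (LINT x|M. max 0 (- f x) * g x)"
    unfolding signed_integral_def with_density_uminus[symmetric]
    using f by (simp add: positive_part_with_density[OF M] integral_density)
  also have "\<dots> = (LINT x|M. max 0 (f x) * g x - max 0 (- f x) * g x)"
    using int by simp
  also have "\<dots> = (LINT x|M. f x * g x)"
    by (intro Bochner_Integration.integral_cong) (auto simp: max_def)
  finally show ?thesis .
qed

lemma integrable_mult_AE_bounded:
  fixes f g :: "'a \<Rightarrow> real"
  assumes f: "integrable M f" and g: "g \<in> borel_measurable M" "AE x in M. \<bar>g x\<bar> \<le> C"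
  shows "integrable M (\<lambda>x. f x * g x)"
proof (rule Bochner_Integration.integrable_bound)
  show "integrable M (\<lambda>x. C * f x)"
    using f by simp
  show "(\<lambda>x. f x * g x) \<in> borel_measurable M"
    using f g by simp
  show "AE x in M. norm (f x * g x) \<le> norm (C * f x)"
    using g(2)
  proof eventually_elim
    case (elim x)
    then have "\<bar>g x\<bar> * \<bar>f x\<bar> \<le> \<bar>C\<bar> * \<bar>f x\<bar>"
      by (intro mult_right_mono) auto
    then show ?case
      by (simp add: abs_mult mult.commute)
  qed
qed

text \<open>The complement of the support is the union of all open null sets; by the Lindelof
  property countably many of them already cover it.\<close>

lemma emeasure_Compl_support:
  fixes M :: "'a::second_countable_topology measure"
  assumes M: "sets M = sets borel"
  shows "emeasure M (- support M) = 0"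
proof -
  define F where "F = {U. open U \<and> emeasure M U = 0}"
  have "- support M = \<Union>F"
    by (auto simp: support_def F_def not_gr_zero)
  moreover obtain F' where F': "F' \<subseteq> F" "countable F'" "\<Union>F' = \<Union>F"
    using Lindelof[of F] by (auto simp: F_def)
  moreover have "(\<Union>U\<in>F'. U) \<in> null_sets M"
    using F' M by (intro null_sets_UN') (auto simp: F_def null_sets_def)
  ultimately show ?thesis
    by auto
qed

section \<open>Positive functionals on integrable functions that are dominated by the
  integral\<close>

text \<open>The set function \<open>A \<mapsto> T (indicator A)\<close> is a finite measure
  dominated by \<open>M\<close>, so Radon-Nikodym provides a density with values in [0, 1] almost
  everywhere. The formula passes from indicators to all integrable functions because positivity and
  domination force \<open>T\<close> to be continuous in the L1 norm.\<close>

lemma L1_functional_representation: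
  fixes T :: "('a \<Rightarrow> real) \<Rightarrow> real"
  assumes "finite_measure M"
    and add: "\<And>f g. integrable M f \<Longrightarrow> integrable M g \<Longrightarrow> T (\<lambda>x. f x + g x) = T f + T g"
    and scale: "\<And>c f. integrable M f \<Longrightarrow> T (\<lambda>x. c * f x) = c * T f"
    and nonneg: "\<And>f. integrable M f \<Longrightarrow> (\<And>x. 0 \<le> f x) \<Longrightarrow> 0 \<le> T f"
    and le: "\<And>f. integrable M f \<Longrightarrow> (\<And>x. 0 \<le> f x) \<Longrightarrow> T f \<le> (LINT x|M. f x)"
  obtains u where "u \<in> L_infinity M"
    and "\<And>h. integrable M h \<Longrightarrow> T h = (LINT x|M. h x * u x)"
proof -
  interpret finite_measure M by fact
  have diff: "T (\<lambda>x. f x - g x) = T f - T g" if "integrable M f" "integrable M g" for f g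
    using add[of f "\<lambda>x. -1 * g x"] scale[of g "-1"] that by simp
  \<comment> \<open>On the positive and the negative part of \<open>h\<close>, \<open>T\<close> lies
    between 0 and the integral, so their difference is bounded by the sum of the two
    integrals.\<close>
  have abs_le: "\<bar>T h\<bar> \<le> (LINT x|M. \<bar>h x\<bar>)" if h: "integrable M h" for h
  proof -
    have int: "integrable M (\<lambda>x. max 0 (h x))" "integrable M (\<lambda>x. max 0 (- h x))"
      using h by auto
    have "T h = T (\<lambda>x. max 0 (h x) - max 0 (- h x))"
      by (rule arg_cong[where f = T]) (auto simp: max_def)
    also have "\<dots> = T (\<lambda>x. max 0 (h x)) - T (\<lambda>x. max 0 (- h x))"
      by (rule diff[OF int])
    finally have T: "T h = T (\<lambda>x. max 0 (h x)) - T (\<lambda>x. max 0 (- h x))" .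
    have "(LINT x|M. \<bar>h x\<bar>) = (LINT x|M. max 0 (h x) + max 0 (- h x))"
      by (intro Bochner_Integration.integral_cong) (auto simp: max_def)
    also have "\<dots> = (LINT x|M. max 0 (h x)) + (LINT x|M. max 0 (- h x))"
      using int by simp
    finally show ?thesis
      using T nonneg[OF int(1)] nonneg[OF int(2)] le[OF int(1)] le[OF int(2)] by simp
  qed
  have ind: "integrable M (indicator A :: 'a \<Rightarrow> real)" if "A \<in> sets M" for A
    using that by (intro integrable_real_indicator) (simp_all add: less_top[symmetric])
  have ind0: "0 \<le> T (indicator A)" if "A \<in> sets M" for A
    using nonneg[OF ind[OF that]] by simp
  have ind1: "T (indicator A) \<le> measure M A" if "A \<in> sets M" for A
    using le[OF ind[OF that]] that by simp
  have T0: "T (\<lambda>x. 0) = 0"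
    using scale[of "\<lambda>x. 0" 0] by simp
  have Tsum: "T (\<lambda>x. \<Sum>i\<in>I. f i x) = (\<Sum>i\<in>I. T (f i))"
    if "finite I" "\<And>i. i \<in> I \<Longrightarrow> integrable M (f i)" for I :: "nat set" and f
    using that by (induction I rule: finite_induct) (simp_all add: T0 add)
  have sums: "(\<lambda>i. T (indicator (A i))) sums T (indicator (\<Union>i. A i))"
    if A: "range A \<subseteq> sets M" "disjoint_family A" for A :: "nat \<Rightarrow> 'a set"
  proof -
    have Ai: "A i \<in> sets M" for i
      using A by auto
    have "(\<lambda>n. measure M (\<Union>i. A i) - (\<Sum>i<n. measure M (A i))) \<longlonglongrightarrow>
        measure M (\<Union>i. A i) - measure M (\<Union>i. A i)"
      using finite_measure_UNION[OF A] by (intro tendsto_intros) (simp add: sums_def)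
    then have lim: "(\<lambda>n. measure M (\<Union>i. A i) - (\<Sum>i<n. measure M (A i))) \<longlonglongrightarrow> 0"
      by simp
    \<comment> \<open>By disjointness, \<open>d\<close> below is the indicator of the union of the
      sets with index at least \<open>n\<close>; its integral is the tail of the convergent series
      of measures.\<close>
    have bound: "norm (T (indicator (\<Union>i. A i)) - (\<Sum>i<n. T (indicator (A i)))) \<le>
        measure M (\<Union>i. A i) - (\<Sum>i<n. measure M (A i))" for n
    proof -
      define d :: "'a \<Rightarrow> real" where "d x = indicator (\<Union>i. A i) x - (\<Sum>i<n. indicator (A i) x)" for x
      have "(\<Sum>i<n. indicator (A i) x) = (indicator (\<Union>i<n. A i) x :: real)" for x
        using A(2) by (subst indicator_UN_disjoint) (auto simp: disjoint_family_on_def)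
      then have d0: "0 \<le> d x" for x
        by (auto simp: d_def split: split_indicator)
      have "integrable M d"
        using Ai ind unfolding d_def by auto
      moreover have "T d = T (indicator (\<Union>i. A i)) - (\<Sum>i<n. T (indicator (A i)))"
        unfolding d_def using Ai ind by (subst diff) (auto simp: Tsum)
      moreover have "(LINT x|M. \<bar>d x\<bar>) = measure M (\<Union>i. A i) - (\<Sum>i<n. measure M (A i))"
        using d0 Ai ind by (simp add: d_def)
      ultimately show ?thesis
        using abs_le[of d] by simp
    qed
    have "(\<lambda>n. T (indicator (\<Union>i. A i)) - (\<Sum>i<n. T (indicator (A i)))) \<longlonglongrightarrow> 0"
      by (rule Lim_null_comparison[OF always_eventually lim]) (use bound in blast)
    from tendsto_diff[OF tendsto_const[of "T (indicator (\<Union>i. A i))"] this]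
    show ?thesis
      by (simp add: sums_def)
  qed
  define N where "N = measure_of (space M) (sets M) (\<lambda>A. ennreal (T (indicator A)))"
  have setsN: "sets N = sets M"
    by (simp add: N_def sets.sigma_sets_eq sets.space_closed)
  have spaceN: "space N = space M"
    using sets_eq_imp_space_eq[OF setsN] .
  have N: "emeasure N A = ennreal (T (indicator A))" if "A \<in> sets M" for A
    unfolding N_def
  proof (rule emeasure_measure_of_sigma)
    show "sigma_algebra (space M) (sets M)" ..
    show "positive (sets M) (\<lambda>A. ennreal (T (indicator A)))"
      using T0 by (simp add: positive_def indicator_def[abs_def])
    show "countably_additive (sets M) (\<lambda>A. ennreal (T (indicator A)))"
    proof (rule countably_additiveI)
      fix A :: "nat \<Rightarrow> 'a set"
      assume A: "range A \<subseteq> sets M" "disjoint_family A"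
      have "(\<lambda>i. ennreal (T (indicator (A i)))) sums ennreal (T (indicator (\<Union>i. A i)))"
        using A by (subst sums_ennreal) (auto intro!: ind0 sums)
      then show "(\<Sum>i. ennreal (T (indicator (A i)))) = ennreal (T (indicator (\<Union>i. A i)))"
        by (simp add: sums_iff)
    qed
  qed (fact that)
  have "finite_measure N"
    by (rule finite_measureI) (simp add: spaceN N)
  moreover have "absolutely_continuous M N"
    unfolding absolutely_continuous_def
  proof
    fix A assume A: "A \<in> null_sets M"
    then have "T (indicator A) \<le> 0"
      using ind1[OF null_setsD2[OF A]] by (simp add: measure_eq_0_null_sets)
    then show "A \<in> null_sets N"
      using A N[of A] setsN by (auto simp: ennreal_neg null_sets_def)
  qed
  ultimately obtain v where v [measurable]: "v \<in> borel_measurable M" and vN: "density M v = N"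
    using Radon_Nikodym_finite_measure[of N] setsN by auto
  have vA: "(\<integral>\<^sup>+x. v x * indicator A x \<partial>M) = ennreal (T (indicator A))" if "A \<in> sets M" for A
    using emeasure_density[OF v that] N[OF that] vN by simp
  \<comment> \<open>On the set \<open>A\<close> where \<open>v\<close> exceeds 1, the integral of
    \<open>v - 1\<close> is the truncated difference \<open>T (indicator A) - M A\<close>, which is
    0 in \<open>ennreal\<close> by domination.\<close>
  have "AE x in M. v x \<le> 1"
  proof -
    define A where "A = {x \<in> space M. 1 < v x}"
    have A [measurable]: "A \<in> sets M"
      unfolding A_def by measurable
    have "(\<integral>\<^sup>+x. (v x - 1) * indicator A x \<partial>M) =
        (\<integral>\<^sup>+x. v x * indicator A x - indicator A x \<partial>M)"
      by (intro nn_integral_cong) (auto split: split_indicator)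
    also have "\<dots> = (\<integral>\<^sup>+x. v x * indicator A x \<partial>M) - (\<integral>\<^sup>+x. indicator A x \<partial>M)"
      by (rule nn_integral_diff) (auto simp: A_def emeasure_eq_measure split: split_indicator)
    also have "\<dots> = ennreal (T (indicator A)) - ennreal (measure M A)"
      by (simp add: vA emeasure_eq_measure)
    also have "\<dots> = 0"
      using ind1[OF A] by (simp add: ennreal_minus ennreal_neg)
    finally have "AE x in M. (v x - 1) * indicator A x = 0"
      by (subst (asm) nn_integral_0_iff_AE) auto
    then show ?thesis
      using AE_space
    proof eventually_elim
      case (elim x)
      show "v x \<le> 1"
      proof (rule ccontr)
        assume "\<not> v x \<le> 1"
        then have "v x - 1 = 0"
          using elim by (simp add: A_def)
        then show False
          using \<open>\<not> v x \<le> 1\<close> by (simp add: diff_eq_0_iff_ennreal)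
      qed
    qed
  qed
  \<comment> \<open>\<open>enn2real\<close> sends infinity to 0, but \<open>v\<close> is infinite at
    most on a null set, so \<open>u\<close> and \<open>v\<close> agree almost everywhere.\<close>
  define u where "u x = enn2real (v x)" for x
  have u [measurable]: "u \<in> borel_measurable M"
    unfolding u_def by measurable
  have uv: "AE x in M. ennreal (u x) = v x" 
    using \<open>AE x in M. v x \<le> 1\<close>
  proof eventually_elim
    case (elim x)
    then have "v x < top"
      by (rule le_less_trans) simp
    then show ?case
      unfolding u_def by (rule ennreal_enn2real)
  qed
  have u1: "AE x in M. \<bar>u x\<bar> \<le> 1"
    using \<open>AE x in M. v x \<le> 1\<close> uv
  proof eventually_elim
    case (elim x)
    then have "ennreal (u x) \<le> 1"
      by simp
    then show ?case
      by (simp add: u_def)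
  qed
  have uint: "integrable M (\<lambda>x. h x * u x)" if "integrable M h" for h
    using integrable_mult_AE_bounded[OF that u u1] .
  have "T h = (LINT x|M. h x * u x)" if "integrable M h" for h
    using that
  proof (induction rule: integrable_induct)
    case (base A c)
    have "ennreal (T (indicator A)) = (\<integral>\<^sup>+x. ennreal (indicator A x * u x) \<partial>M)"
      unfolding vA[OF base(1), symmetric] using uv
      by (intro nn_integral_cong_AE) (auto elim!: eventually_mono split: split_indicator)
    also have "\<dots> = ennreal (LINT x|M. indicator A x * u x)"
      using base uint[OF ind] by (intro nn_integral_eq_integral) (auto simp: u_def)
    finally have "T (indicator A) = (LINT x|M. indicator A x * u x)"
      using ind0[OF base(1)] by (subst (asm) ennreal_inj) (auto simp: u_def intro!: integral_nonneg)
    then show ?case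
      using scale[OF ind[OF base(1)], of c] by (simp add: mult.commute mult.left_commute)
  next
    case (add f g)
    then show ?case
      using assms(2)[of f g] by (simp add: distrib_right uint)
  next
    \<comment> \<open>Both sides pass to the limit: the left one by \<open>abs_le\<close> and
      convergence in the L1 norm, the right one by dominated convergence, as \<open>u\<close> is
      bounded by 1 almost everywhere.\<close>
    case (lim f s)
    have si: "integrable M (s i)" for i
      by (rule lim)
    have Ti: "T (s i) = (LINT x|M. s i x * u x)" for i
      by (rule lim)
    have conv: "(\<lambda>i. s i x) \<longlonglongrightarrow> f x" if "x \<in> space M" for x
      using that by (rule lim)
    have bound: "norm (s i x) \<le> 2 * norm (f x)" if "x \<in> space M" for i x
      using that by (rule lim)
    have f: "integrable M f"
      by (rule lim)
    have dom: "(\<lambda>i. LINT x|M. norm (s i x - f x)) \<longlonglongrightarrow> 0"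
    proof -
      have "(\<lambda>i. LINT x|M. norm (s i x - f x)) \<longlonglongrightarrow> (LINT x|M. 0)"
      \<comment> \<open>The factor 3 comes from \<open>norm (s i x) \<le> 2 * norm (f x)\<close>
        together with one more \<open>norm (f x)\<close> for the subtracted limit.\<close>
      proof (rule integral_dominated_convergence[where w = "\<lambda>x. 3 * norm (f x)"])
        show "AE x in M. norm (norm (s i x - f x)) \<le> 3 * norm (f x)" for i
        proof (rule AE_I2)
          fix x assume "x \<in> space M"
          then show "norm (norm (s i x - f x)) \<le> 3 * norm (f x)"
            using bound[of x i] abs_triangle_ineq4[of "s i x" "f x"] by simp
        qed
        show "AE x in M. (\<lambda>i. norm (s i x - f x)) \<longlonglongrightarrow> 0"
          using conv by (intro AE_I2) (simp add: LIM_zero tendsto_rabs_zero)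
      qed (use si f in auto)
      then show ?thesis
        by simp
    qed
    have "norm (T (s i) - T f) \<le> (LINT x|M. norm (s i x - f x))" for i
      using abs_le[of "\<lambda>x. s i x - f x"] diff[of "s i" f] si f by simp
    then have T: "(\<lambda>i. T (s i)) \<longlonglongrightarrow> T f"
      by (intro LIM_zero_cancel[OF Lim_null_comparison[OF always_eventually dom]]) blast
    have "(\<lambda>i. LINT x|M. s i x * u x) \<longlonglongrightarrow> (LINT x|M. f x * u x)"
    proof (rule integral_dominated_convergence[where w = "\<lambda>x. 2 * norm (f x)"])
      show "AE x in M. norm (s i x * u x) \<le> 2 * norm (f x)" for i
        using u1 AE_space
      proof eventually_elim
        case (elim x)
        then have "\<bar>s i x\<bar> * \<bar>u x\<bar> \<le> \<bar>s i x\<bar> * 1"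
          by (intro mult_left_mono) auto
        then show ?case
          using bound[of x i] elim by (simp add: abs_mult)
      qed
      show "AE x in M. (\<lambda>i. s i x * u x) \<longlonglongrightarrow> f x * u x"
        using conv by (intro AE_I2 tendsto_intros) auto
    qed (use si f in auto)
    then show ?case
      using LIMSEQ_unique[OF T] Ti by simp
  qed
  moreover have "u \<in> L_infinity M"
    using u u1 by (auto simp: L_infinity_def)
  ultimately show ?thesis
    using that by blast
qed

section \<open>Fine Borel partitions adapted to a compact set\<close>

text \<open>Cover \<open>K\<close> by finitely many balls of radius \<open>e / 2\<close> and put
  points in the same cell when they lie in the same balls, with the empty label for every point
  outside \<open>K\<close>. A point of \<open>K\<close> has a nonempty label, so all of its cell
  lies in \<open>K\<close> and shares a ball with it.\<close>

lemma fine_borel_partition: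
  fixes K :: "'a::metric_space set"
  assumes K: "compact K" and e: "0 < e"
  obtains P where "partition_on UNIV P" "finite P" "P \<subseteq> sets borel"
    and "\<And>C x y. C \<in> P \<Longrightarrow> x \<in> C \<Longrightarrow> y \<in> C \<Longrightarrow> x \<in> K \<Longrightarrow> y \<in> K \<and> dist x y < e"
proof -
  have "K \<subseteq> (\<Union>c\<in>K. ball c (e / 2))"
    using e by (intro subsetI UN_I) auto
  then obtain F where F: "finite F" "K \<subseteq> (\<Union>c\<in>F. ball c (e / 2))"
    using compactE_image[OF K, of K "\<lambda>c. ball c (e / 2)"] open_ball by metis
  define \<phi> where "\<phi> y = {c \<in> F. y \<in> K \<and> y \<in> ball c (e / 2)}" for y
  define P where "P = (\<lambda>y. \<phi> -` {\<phi> y}) ` UNIV"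
  show ?thesis
  proof
    show "partition_on UNIV P"
      by (rule partition_onI) (auto simp: P_def disjnt_def)
    have "finite (range \<phi>)"
      by (rule finite_subset[of _ "Pow F"]) (use F(1) in \<open>auto simp: \<phi>_def\<close>)
    moreover have "P = (\<lambda>S. \<phi> -` {S}) ` range \<phi>"
      by (simp only: P_def image_image)
    ultimately show "finite P"
      by simp
    have [measurable]: "K \<in> sets borel" "ball c (e / 2) \<in> sets borel" for c
      using K by (auto intro: borel_closed compact_imp_closed)
    have "\<phi> -` {S} \<in> sets borel" if "S \<subseteq> F" for S
    proof -
      \<comment> \<open>This writes a level set of \<open>\<phi>\<close> as a finite conjunction of
        Borel conditions, one for each centre in \<open>F\<close>.\<close>
      have "\<phi> -` {S} = {y \<in> space borel. \<forall>c\<in>F. (y \<in> K \<and> y \<in> ball c (e / 2)) \<longleftrightarrow> c \<in> S}"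
      proof (intro set_eqI)
        fix y
        have "\<phi> y = S \<longleftrightarrow> (\<forall>c\<in>F. c \<in> \<phi> y \<longleftrightarrow> c \<in> S)"
          using that by (auto simp: \<phi>_def)
        then show "y \<in> \<phi> -` {S} \<longleftrightarrow>
            y \<in> {y \<in> space borel. \<forall>c\<in>F. (y \<in> K \<and> y \<in> ball c (e / 2)) \<longleftrightarrow> c \<in> S}"
          by (simp add: \<phi>_def)
      qed
      also have "\<dots> \<in> sets borel"
        by (intro sets.sets_Collect_finite_All F(1)) measurable
      finally show ?thesis .
    qed
    then have "\<phi> -` {\<phi> y} \<in> sets borel" for y
      by (simp add: \<phi>_def)
    then show "P \<subseteq> sets borel"
      unfolding P_def by blast
    fix C x y
    assume C: "C \<in> P" "x \<in> C" "y \<in> C" and x: "x \<in> K"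
    from C have eq: "\<phi> x = \<phi> y"
      by (auto simp: P_def)
    obtain c where "c \<in> \<phi> x"
      using F(2) x by (auto simp: \<phi>_def)
    then have "dist c x < e / 2" "dist c y < e / 2" "y \<in> K"
      using eq by (auto simp: \<phi>_def)
    then show "y \<in> K \<and> dist x y < e"
      using dist_triangle_half_r[of c x e y] by auto
  qed
qed

section \<open>Averaging over the cells of a partition\<close>

lemma ac_measures_iff: "l \<in> ac_measures M \<longleftrightarrow> (\<exists>f. integrable M f \<and> l = with_density f M)"
  by (auto simp: ac_measures_def)

lemma markov_transfunctionD:
  assumes "markov_transfunction M N \<Phi>"
  shows "l \<in> ac_measures M \<Longrightarrow> \<Phi> l \<in> ac_measures N"
    and "k \<in> ac_measures M \<Longrightarrow> l \<in> ac_measures M \<Longrightarrow>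
      \<Phi> (\<lambda>A. k A + l A) = (\<lambda>B. \<Phi> k B + \<Phi> l B)"
    and "l \<in> ac_measures M \<Longrightarrow> \<Phi> (\<lambda>A. c * l A) = (\<lambda>B. c * \<Phi> l B)"
    and "l \<in> ac_measures M \<Longrightarrow> 0 < e \<Longrightarrow> \<exists>d>0::real. \<forall>k\<in>ac_measures M.
      tv_norm (\<lambda>A. k A - l A) < ennreal d \<longrightarrow> tv_norm (\<lambda>B. \<Phi> k B - \<Phi> l B) < ennreal e"
    and "l \<in> ac_measures M \<Longrightarrow> nonneg_signed l \<Longrightarrow> nonneg_signed (\<Phi> l)"
    and "l \<in> ac_measures M \<Longrightarrow> \<Phi> l UNIV = l UNIV"
  using assms unfolding markov_transfunction_def transfunction_def by blast+

text \<open>For a Borel set \<open>C\<close> of finite positive measure this is the conditional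
  probability \<open>B \<mapsto> N (B \<inter> C) / N C\<close>. Giving it by a density makes its
  bounded absolute continuity visible.\<close>

definition normalized_restriction :: "'a::topological_space measure \<Rightarrow> 'a set \<Rightarrow> 'a signed" where
  "normalized_restriction N C = with_density (\<lambda>x. indicator C x / measure N C) N"

text \<open>
  Cells of measure 0 contribute nothing, since division by 0 gives 0; no mass is lost because \<open>l\<close> is
  absolutely continuous.
\<close>

definition cell_average ::
  "'b::topological_space measure \<Rightarrow> 'b set set \<Rightarrow> 'b signed \<Rightarrow> 'b signed" where
  "cell_average N P l = (\<lambda>B. \<Sum>C\<in>P. l C * normalized_restriction N C B)"

context
  fixes N :: "'b::topological_space measure" and P :: "'b set set"
  assumes N: "sets N = sets borel" "finite_measure N"
    and P: "partition_on UNIV P" "finite P" "P \<subseteq> sets borel"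
begin

interpretation finite_measure N by (fact N)

lemma cell_sets: "C \<in> P \<Longrightarrow> C \<in> sets N"
  using N P by auto

lemma normalized_restriction_nonneg: "0 \<le> normalized_restriction N C B"
  by (auto simp: normalized_restriction_def intro!: with_density_nonneg)

lemma integrable_cell_indicator: "C \<in> P \<Longrightarrow> integrable N (\<lambda>x. indicator C x / measure N C)"
  using cell_sets[of C]
  by (auto intro!: integrable_real_indicator simp: less_top[symmetric])

lemma normalized_restriction_UNIV:
  assumes "C \<in> P"
  shows "normalized_restriction N C UNIV = (if measure N C = 0 then 0 else 1)"
  using cell_sets[OF assms] N
  by (auto simp: normalized_restriction_def with_density_eq)

text \<open>Linearity turns the average into a measure with a step density, constant on each cell.
  This puts it in \<open>ac_measures N\<close> and makes \<open>signed_integral_with_density\<close>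
  applicable.\<close>

lemma cell_average_eq_with_density:
  "cell_average N P l = with_density (\<lambda>x. \<Sum>C\<in>P. l C * (indicator C x / measure N C)) N"
proof -
  have "with_density (\<lambda>x. \<Sum>C\<in>P. l C * (indicator C x / measure N C)) N =
      (\<lambda>B. \<Sum>C\<in>P. with_density (\<lambda>x. l C * (indicator C x / measure N C)) N B)"
    using P(2) integrable_cell_indicator by (intro with_density_sum integrable_mult_right) auto
  then show ?thesis
    by (simp add: cell_average_def normalized_restriction_def with_density_cmult del: times_divide_eq_right)
qed

lemma integrable_cell_average:
  "integrable N (\<lambda>x. \<Sum>C\<in>P. l C * (indicator C x / measure N C))"
  using integrable_cell_indicator by (intro Bochner_Integration.integrable_sum integrable_mult_right) auto

lemma cell_average_in_ac: "cell_average N P l \<in> ac_measures N"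
  unfolding ac_measures_iff cell_average_eq_with_density using integrable_cell_average by blast

lemma normalized_restriction_in_ac_infinity:
  assumes "C \<in> P"
  shows "normalized_restriction N C \<in> ac_measures_infinity N"
proof -
  have "(\<lambda>x. indicator C x / measure N C) \<in> L_infinity N"
    using cell_sets[OF assms]
    by (auto simp: L_infinity_def intro!: exI[of _ "1 / measure N C"] AE_I2 split: split_indicator)
  then show ?thesis
    unfolding ac_measures_infinity_def normalized_restriction_def by blast
qed

text \<open>A cell of positive measure keeps its mass \<open>l C\<close> because the normalized
  restriction has mass 1; on a null cell \<open>l C\<close> is 0 by absolute continuity.\<close>

lemma cell_average_UNIV:
  assumes "l \<in> ac_measures N"
  shows "cell_average N P l UNIV = l UNIV"
proof -
  obtain h where h: "integrable N h" "l = with_density h N"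
    using assms by (auto simp: ac_measures_iff)
  have "l C * normalized_restriction N C UNIV = l C" if "C \<in> P" for C
    using that h with_density_null[of N C h]
    by (auto simp: normalized_restriction_UNIV emeasure_eq_measure)
  then have "cell_average N P l UNIV = (\<Sum>C\<in>P. l C)"
    unfolding cell_average_def by (intro sum.cong) auto
  also have "\<dots> = l UNIV"
    using with_density_partition[OF N(1) h(1) P] h by simp
  finally show ?thesis .
qed

text \<open>The normalized restrictions are nonnegative of mass at most 1, so the variation of the
  average along any partition \<open>Q\<close> is at most the sum of \<open>\<bar>l C\<bar>\<close>
  over \<open>P\<close>. Since \<open>P\<close> is itself a finite Borel partition, that sum is a
  competitor in the supremum for \<open>l\<close>.\<close>

lemma tv_norm_cell_average_le: "tv_norm (cell_average N P l) \<le> tv_norm l"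
  unfolding tv_norm_def
proof (rule SUP_least, clarify)
  fix Q :: "'b set set"
  assume Q: "partition_on UNIV Q" "finite Q" "Q \<subseteq> sets borel"
  \<comment> \<open>The sum is the total mass, which is 1 for a cell of positive measure and 0 for a
    null cell.\<close>
  have one: "(\<Sum>B\<in>Q. normalized_restriction N C B) \<le> 1" if "C \<in> P" for C
    using with_density_partition[OF N(1) integrable_cell_indicator[OF that] Q]
      normalized_restriction_UNIV[OF that]
    by (simp add: normalized_restriction_def)
  have "(\<Sum>B\<in>Q. \<bar>cell_average N P l B\<bar>) \<le> (\<Sum>B\<in>Q. \<Sum>C\<in>P. \<bar>l C\<bar> * normalized_restriction N C B)"
    unfolding cell_average_def
    by (intro sum_mono order_trans[OF sum_abs])
      (simp add: abs_mult normalized_restriction_nonneg)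
  also have "\<dots> = (\<Sum>C\<in>P. \<bar>l C\<bar> * (\<Sum>B\<in>Q. normalized_restriction N C B))"
    by (subst sum.swap) (simp add: sum_distrib_left)
  also have "\<dots> \<le> (\<Sum>C\<in>P. \<bar>l C\<bar>)"
    using one by (intro sum_mono) (simp add: mult_left_le)
  finally have "(\<Sum>B\<in>Q. ennreal \<bar>cell_average N P l B\<bar>) \<le> (\<Sum>C\<in>P. ennreal \<bar>l C\<bar>)"
    by (simp add: sum_ennreal ennreal_leI)
  also have "\<dots> \<le> (SUP P\<in>{P. partition_on UNIV P \<and> finite P \<and> P \<subseteq> sets borel}. \<Sum>A\<in>P. ennreal \<bar>l A\<bar>)"
    using P by (intro SUP_upper) auto
  finally show "(\<Sum>B\<in>Q. ennreal \<bar>cell_average N P l B\<bar>) \<le>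
    (SUP P\<in>{P. partition_on UNIV P \<and> finite P \<and> P \<subseteq> sets borel}. \<Sum>A\<in>P. ennreal \<bar>l A\<bar>)" .
qed

text \<open>Averaging is linear and contracts \<open>tv_norm\<close>, so the \<open>d\<close> that
  serves \<open>\<Phi>\<close> for a given \<open>e\<close> also serves the composite.\<close>

lemma markov_cell_average:
  assumes "markov_transfunction M N \<Phi>"
  shows "markov_transfunction M N (\<lambda>l. cell_average N P (\<Phi> l))"
  unfolding markov_transfunction_def
proof (intro conjI ballI allI impI)
  note markov = markov_transfunctionD[OF assms]
  show "transfunction M N (\<lambda>l. cell_average N P (\<Phi> l))"
    by (auto simp: transfunction_def cell_average_in_ac)
  show "cell_average N P (\<Phi> (\<lambda>A. k A + l A)) =
      (\<lambda>B. cell_average N P (\<Phi> k) B + cell_average N P (\<Phi> l) B)"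
    if "k \<in> ac_measures M" "l \<in> ac_measures M" for k l
    using markov(2)[OF that] by (simp add: cell_average_def distrib_right sum.distrib)
  show "cell_average N P (\<Phi> (\<lambda>A. c * l A)) = (\<lambda>B. c * cell_average N P (\<Phi> l) B)"
    if "l \<in> ac_measures M" for c l
    using markov(3)[OF that] by (simp add: cell_average_def sum_distrib_left mult.assoc)
  show "\<exists>d>0. \<forall>k\<in>ac_measures M. tv_norm (\<lambda>A. k A - l A) < ennreal d \<longrightarrow>
      tv_norm (\<lambda>B. cell_average N P (\<Phi> k) B - cell_average N P (\<Phi> l) B) < ennreal e"
    if l: "l \<in> ac_measures M" "0 < e" for l and e :: real
  proof -
    obtain d where d: "0 < d" "\<And>k. k \<in> ac_measures M \<Longrightarrow> tv_norm (\<lambda>A. k A - l A) < ennreal d \<Longrightarrow>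
        tv_norm (\<lambda>B. \<Phi> k B - \<Phi> l B) < ennreal e"
      using markov(4)[OF l] by blast
    have "(\<lambda>B. cell_average N P (\<Phi> k) B - cell_average N P (\<Phi> l) B) =
        cell_average N P (\<lambda>B. \<Phi> k B - \<Phi> l B)" for k
      by (simp add: cell_average_def left_diff_distrib sum_subtractf)
    then have le: "tv_norm (\<lambda>B. cell_average N P (\<Phi> k) B - cell_average N P (\<Phi> l) B) \<le>
        tv_norm (\<lambda>B. \<Phi> k B - \<Phi> l B)" for k
      by (simp add: tv_norm_cell_average_le)
    show ?thesis
      using d(1) by (intro exI[of _ d] conjI ballI impI le_less_trans[OF le d(2)])
  qed
  show "nonneg_signed (cell_average N P (\<Phi> l))" if "l \<in> ac_measures M" "nonneg_signed l" for l
  proof -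
    have "nonneg_signed (\<Phi> l)"
      using markov(5) that by blast
    then show ?thesis
      using P(3) normalized_restriction_nonneg
      by (auto simp: nonneg_signed_def cell_average_def intro!: sum_nonneg mult_nonneg_nonneg)
  qed
  show "cell_average N P (\<Phi> l) UNIV = l UNIV" if "l \<in> ac_measures M" for l
    using markov(1,6)[OF that] by (simp add: cell_average_UNIV)
qed

text \<open>The coefficient \<open>\<Phi> l C\<close> of each cell is a positive functional of the
  density of \<open>l\<close>, hence integration against a bounded function by
  \<open>L1_functional_representation\<close>.\<close>

lemma simple_cell_average:
  assumes M: "sets M = sets borel" "finite_measure M" and markov: "markov_transfunction M N \<Phi>"
  shows "simple_transfunction M N (\<lambda>l. cell_average N P (\<Phi> l))"
proof -
  note markov' = markov_transfunctionD[OF markov]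
  have ac: "with_density f M \<in> ac_measures M" if "integrable M f" for f
    using that by (auto simp: ac_measures_iff)
  have "\<exists>u. u \<in> L_infinity M \<and> (\<forall>l\<in>ac_measures M. \<Phi> l C = signed_integral l u)" if C: "C \<in> P" for C
  proof -
    have UC: "UNIV \<in> sets borel" "- C \<in> sets borel" "C \<in> sets borel"
      using C P by auto
    have nonneg: "0 \<le> \<Phi> (with_density f M) B"
      if "integrable M f" "\<And>x. 0 \<le> f x" "B \<in> sets borel" for f B
    proof -
      have "nonneg_signed (with_density f M)"
        using that with_density_nonneg[of f M] by (auto simp: nonneg_signed_def)
      then have "nonneg_signed (\<Phi> (with_density f M))"
        using markov'(5) ac[OF that(1)] by blast
      then show ?thesis
        using that by (auto simp: nonneg_signed_def)
    qed
    obtain u where u: "u \<in> L_infinity M"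
      and T: "\<And>h. integrable M h \<Longrightarrow> \<Phi> (with_density h M) C = (LINT x|M. h x * u x)"
    proof (rule L1_functional_representation[OF M(2), of "\<lambda>f. \<Phi> (with_density f M) C"])
      show "\<Phi> (with_density (\<lambda>x. f x + g x) M) C = \<Phi> (with_density f M) C + \<Phi> (with_density g M) C"
        if "integrable M f" "integrable M g" for f g
        using markov'(2)[OF ac ac] that by (simp add: with_density_add)
      show "\<Phi> (with_density (\<lambda>x. c * f x) M) C = c * \<Phi> (with_density f M) C"
        if "integrable M f" for c f
        using markov'(3)[OF ac] that by (simp add: with_density_cmult)
      show "0 \<le> \<Phi> (with_density f M) C" if "integrable M f" "\<And>x. 0 \<le> f x" for f
        using nonneg that UC by blast
      show "\<Phi> (with_density f M) C \<le> (LINT x|M. f x)" if f: "integrable M f" "\<And>x. 0 \<le> f x" for f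
      proof -
        obtain h where h: "integrable N h" "\<Phi> (with_density f M) = with_density h N"
          using markov'(1)[OF ac[OF f(1)]] by (auto simp: ac_measures_iff)
        \<comment> \<open>By positivity one cell carries at most the total mass, and mass
          preservation identifies the total mass with the integral of \<open>f\<close>.\<close>
        have "\<Phi> (with_density f M) C \<le> (\<Sum>C\<in>P. \<Phi> (with_density f M) C)"
          using C P nonneg[OF f] by (intro member_le_sum) auto
        also have "\<dots> = \<Phi> (with_density f M) UNIV"
          using with_density_partition[OF N(1) h(1) P] h by simp
        also have "\<dots> = with_density f M UNIV"
          using markov'(6) ac[OF f(1)] by blast
        also have "\<dots> = (LINT x|M. f x)"
          using M by (simp add: with_density_eq)
        finally show ?thesis .
      qed
    qed (use that in blast)
    have S: "signed_integral (with_density h M) u = (LINT x|M. h x * u x)" if "integrable M h" for h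
      using u that M
      by (auto simp: L_infinity_def intro!: signed_integral_with_density integrable_mult_AE_bounded)
    show ?thesis
    proof (intro exI[of _ u] conjI ballI)
      fix l assume "l \<in> ac_measures M"
      then show "\<Phi> l C = signed_integral l u"
        unfolding ac_measures_iff using T S by auto
    qed (fact u)
  qed
  then obtain u where u: "\<And>C. C \<in> P \<Longrightarrow> u C \<in> L_infinity M"
    "\<And>C l. C \<in> P \<Longrightarrow> l \<in> ac_measures M \<Longrightarrow> \<Phi> l C = signed_integral l (u C)"
    by metis
  \<comment> \<open>Simple transfunctions are sums indexed by an initial segment of the naturals, so
    the cells are enumerated.\<close>
  obtain b where b: "bij_betw b {0..<card P} P"
    using ex_bij_betw_nat_finite[OF P(2)] by blast
  then have bP: "b i \<in> P" if "i < card P" for i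
    using that by (auto simp: bij_betw_def)
  have "cell_average N P (\<Phi> l) =
      (\<lambda>B. \<Sum>i<card P. signed_integral l (u (b i)) * normalized_restriction N (b i) B)"
    if "l \<in> ac_measures M" for l
  proof
    fix B
    have "cell_average N P (\<Phi> l) B = (\<Sum>i<card P. \<Phi> l (b i) * normalized_restriction N (b i) B)"
      unfolding cell_average_def
      using sum.reindex_bij_betw[OF b, of "\<lambda>C. \<Phi> l C * normalized_restriction N C B"]
      by (simp add: lessThan_atLeast0)
    then show "cell_average N P (\<Phi> l) B =
        (\<Sum>i<card P. signed_integral l (u (b i)) * normalized_restriction N (b i) B)"
      using u(2) bP that by simp
  qed
  then show ?thesis
    unfolding simple_transfunction_def
    using u(1) bP normalized_restriction_in_ac_infinity markov_cell_average[OF markov]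
    by (intro conjI exI[of _ "card P"] exI[of _ "\<lambda>i. u (b i)"]
        exI[of _ "\<lambda>i. normalized_restriction N (b i)"])
      (auto simp: markov_transfunction_def)
qed

section \<open>The error that averaging makes against a test function\<close>

text \<open>Integrating \<open>g\<close> against the average replaces \<open>g\<close> on each cell
  by its mean there, which is within \<open>e\<close> of every value of \<open>g\<close> on the
  cell. The error on a cell \<open>C\<close> is thus at most \<open>e\<close> times the integral of
  \<open>\<bar>h\<bar>\<close> over \<open>C\<close>.\<close>

lemma signed_integral_cell_average_diff:
  assumes h: "integrable N h" and g: "g \<in> borel_measurable N" "\<And>x. \<bar>g x\<bar> \<le> c"
    and osc: "\<And>C x y. C \<in> P \<Longrightarrow> measure N C \<noteq> 0 \<Longrightarrow> x \<in> C \<Longrightarrow> y \<in> C \<Longrightarrow> \<bar>g x - g y\<bar> \<le> e"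
  shows "\<bar>signed_integral (cell_average N P (with_density h N)) g - signed_integral (with_density h N) g\<bar>
    \<le> e * (LINT x|N. \<bar>h x\<bar>)"
proof -
  define l where "l = with_density h N"
  have gi: "integrable N (\<lambda>x. f x * g x)" if "integrable N f" for f
    using integrable_mult_AE_bounded[OF that g(1), of c] g(2) by auto
  have one: "(LINT x|N. indicator C x) = measure N C" if "C \<in> P" for C
    using cell_sets[OF that] by simp
  have ind: "integrable N (indicator C :: 'b \<Rightarrow> real)" if "C \<in> P" for C
    using cell_sets[OF that] by (intro integrable_real_indicator) (auto simp: less_top[symmetric])
  \<comment> \<open>The mean of \<open>g\<close> over \<open>C\<close>; division by 0 makes it 0 on
    a null cell, where the integral of \<open>h * g\<close> vanishes as well.\<close>
  define a where "a C = (LINT x|N. indicator C x * g x) / measure N C" for C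
  have near: "\<bar>a C - g x\<bar> \<le> e" if C: "C \<in> P" "measure N C \<noteq> 0" "x \<in> C" for C x
  proof -
    have pos: "0 < measure N C"
      using C(2) by (simp add: zero_less_measure_iff)
    have "\<bar>(LINT y|N. indicator C y * g y) - measure N C * g x\<bar> =
        \<bar>LINT y|N. indicator C y * g y - indicator C y * g x\<bar>"
      using gi[OF ind[OF C(1)]] ind[OF C(1)] one[OF C(1)] by simp
    also have "\<dots> \<le> (LINT y|N. \<bar>indicator C y * g y - indicator C y * g x\<bar>)"
      by (rule integral_abs_bound)
    also have "\<dots> \<le> (LINT y|N. indicator C y * e)"
      using gi[OF ind[OF C(1)]] ind[OF C(1)] osc C
      by (intro integral_mono) (auto split: split_indicator)
    also have "\<dots> = measure N C * e"
      using ind[OF C(1)] one[OF C(1)] by simp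
    finally have "\<bar>(LINT y|N. indicator C y * g y) - measure N C * g x\<bar> / measure N C \<le> e"
      using pos by (simp add: pos_divide_le_eq mult.commute)
    moreover have "\<bar>(LINT y|N. indicator C y * g y) - measure N C * g x\<bar> / measure N C = \<bar>a C - g x\<bar>"
      using pos by (subst abs_div_pos) (simp_all add: a_def diff_divide_distrib)
    ultimately show ?thesis by simp
  qed
  have intC: "integrable N (\<lambda>x. indicator C x * h x)" if "C \<in> P" for C
    using integrable_indicator_times[OF h cell_sets[OF that]] .
  have intCg: "integrable N (\<lambda>x. indicator C x * (h x * g x))" if "C \<in> P" for C
    using integrable_indicator_times[OF gi[OF h] cell_sets[OF that]] .
  have part: "(\<Sum>C\<in>P. LINT x|N. indicator C x * f x) = (LINT x|N. f x)" if "integrable N f"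
    for f :: "'b \<Rightarrow> real"
    using with_density_partition[OF N(1) that P] cell_sets N
    by (simp add: with_density_eq)
  have cell: "\<bar>l C * a C - (LINT x|N. indicator C x * (h x * g x))\<bar> \<le> e * (LINT x|N. indicator C x * \<bar>h x\<bar>)"
    if C: "C \<in> P" for C
  proof (cases "measure N C = 0")
    case True
    then have "(LINT x|N. indicator C x * f x) = 0" for f :: "'b \<Rightarrow> real"
      using with_density_null[of N C f] with_density_eq[OF cell_sets[OF C], of f]
      by (simp add: emeasure_eq_measure)
    then show ?thesis
      using True by (simp add: a_def)
  next
    case False
    have "l C * a C - (LINT x|N. indicator C x * (h x * g x)) =
        (LINT x|N. indicator C x * h x * a C - indicator C x * (h x * g x))"
      using intC[OF C] intCg[OF C] by (simp add: l_def with_density_eq cell_sets[OF C])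
    also have "\<bar>\<dots>\<bar> \<le> (LINT x|N. \<bar>indicator C x * h x * a C - indicator C x * (h x * g x)\<bar>)"
      by (rule integral_abs_bound)
    also have "\<dots> \<le> (LINT x|N. e * (indicator C x * \<bar>h x\<bar>))"
    proof (rule integral_mono)
      show "integrable N (\<lambda>x. \<bar>indicator C x * h x * a C - indicator C x * (h x * g x)\<bar>)"
        using intC[OF C] intCg[OF C] by auto
      show "integrable N (\<lambda>x. e * (indicator C x * \<bar>h x\<bar>))"
        using integrable_indicator_times[of N "\<lambda>x. \<bar>h x\<bar>" C] h cell_sets[OF C] by auto
      fix x
      have "\<bar>h x\<bar> * \<bar>a C - g x\<bar> \<le> \<bar>h x\<bar> * e" if "x \<in> C"
        using near[OF C False that] by (intro mult_left_mono) auto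
      then show "\<bar>indicator C x * h x * a C - indicator C x * (h x * g x)\<bar> \<le> e * (indicator C x * \<bar>h x\<bar>)"
        by (auto simp: abs_mult[symmetric] right_diff_distrib mult.commute split: split_indicator)
    qed
    finally show ?thesis
      by simp
  qed
  have "signed_integral (cell_average N P l) g =
      (LINT x|N. (\<Sum>C\<in>P. l C * (indicator C x / measure N C)) * g x)"
    unfolding cell_average_eq_with_density
    by (rule signed_integral_with_density[OF N(1) integrable_cell_average g(1) gi[OF integrable_cell_average]])
  also have "\<dots> = (LINT x|N. (\<Sum>C\<in>P. (l C / measure N C) * (indicator C x * g x)))"
    by (simp add: sum_distrib_right mult.assoc)
  also have "\<dots> = (\<Sum>C\<in>P. l C * a C)"
    using gi[OF ind] by (subst Bochner_Integration.integral_sum) (auto simp: a_def)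
  finally have 1: "signed_integral (cell_average N P l) g = (\<Sum>C\<in>P. l C * a C)" .
  have 2: "signed_integral l g = (\<Sum>C\<in>P. LINT x|N. indicator C x * (h x * g x))"
    unfolding l_def using signed_integral_with_density[OF N(1) h g(1) gi[OF h]] part[OF gi[OF h]] by simp
  have "\<bar>signed_integral (cell_average N P l) g - signed_integral l g\<bar> \<le>
      (\<Sum>C\<in>P. \<bar>l C * a C - (LINT x|N. indicator C x * (h x * g x))\<bar>)"
    unfolding 1 2 sum_subtractf[symmetric] by (rule sum_abs)
  also have "\<dots> \<le> (\<Sum>C\<in>P. e * (LINT x|N. indicator C x * \<bar>h x\<bar>))"
    by (intro sum_mono cell)
  also have "\<dots> = e * (LINT x|N. \<bar>h x\<bar>)"
    using part[of "\<lambda>x. \<bar>h x\<bar>"] h by (simp add: sum_distrib_left[symmetric])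
  finally show ?thesis
    by (simp add: l_def)
qed

end

section \<open>Partitions of vanishing mesh and weak convergence\<close>

theorem theorem8p4:
  fixes \<mu> :: "'a::polish_space measure" and \<nu> :: "'b::polish_space measure"
    and \<Phi> :: "'a signed \<Rightarrow> 'b signed"
  assumes "locally_compact_space (euclidean :: 'a topology)"
    and "locally_compact_space (euclidean :: 'b topology)"
    and "sets \<mu> = sets borel" and "finite_measure \<mu>" and "compact (support \<mu>)"
    and "sets \<nu> = sets borel" and "finite_measure \<nu>" and "compact (support \<nu>)"
    and "tv_norm (measure \<mu>) = tv_norm (measure \<nu>)"
    and "markov_transfunction \<mu> \<nu> \<Phi>"
  shows "\<exists>\<Psi> :: nat \<Rightarrow> 'a signed \<Rightarrow> 'b signed.
    (\<forall>n\<ge>1. markov_transfunction \<mu> \<nu> (\<Psi> n) \<and> simple_transfunction \<mu> \<nu> (\<Psi> n)) \<and>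
    (\<forall>l\<in>ac_measures \<mu>. weakly_converges (\<lambda>n. \<Psi> n l) (\<Phi> l))"
proof -
  define K where "K = support \<nu>"
  have K: "compact K"
    using assms by (simp add: K_def)
  have "\<exists>P. partition_on UNIV P \<and> finite P \<and> P \<subseteq> sets borel \<and>
    (\<forall>C\<in>P. \<forall>x\<in>C. \<forall>y\<in>C. x \<in> K \<longrightarrow> y \<in> K \<and> dist x y < 1 / real (Suc n))" for n
    by (rule fine_borel_partition[OF K, of "1 / real (Suc n)"]) (simp, blast)
  then obtain P where P: "\<And>n. partition_on UNIV (P n)" "\<And>n. finite (P n)" "\<And>n. P n \<subseteq> sets borel"
    and fine: "\<And>n C x y. C \<in> P n \<Longrightarrow> x \<in> C \<Longrightarrow> y \<in> C \<Longrightarrow> x \<in> K \<Longrightarrow> y \<in> K \<and> dist x y < 1 / real (Suc n)"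
    by metis
  define \<Psi> where "\<Psi> n l = cell_average \<nu> (P n) (\<Phi> l)" for n l
  show ?thesis
  proof (intro exI conjI allI impI ballI)
    fix n :: nat
    show "markov_transfunction \<mu> \<nu> (\<Psi> n)"
      unfolding \<Psi>_def by (rule markov_cell_average[OF assms(6,7) P assms(10)])
    show "simple_transfunction \<mu> \<nu> (\<Psi> n)"
      unfolding \<Psi>_def by (rule simple_cell_average[OF assms(6,7) P assms(3,4,10)])
  next
    fix l assume "l \<in> ac_measures \<mu>"
    then have "\<Phi> l \<in> ac_measures \<nu>"
      by (rule markov_transfunctionD(1)[OF assms(10)])
    then obtain h where h: "integrable \<nu> h" "\<Phi> l = with_density h \<nu>"
      by (auto simp: ac_measures_iff)
    show "weakly_converges (\<lambda>n. \<Psi> n l) (\<Phi> l)"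
      unfolding weakly_converges_def
    proof (intro allI impI)
      fix g :: "'b \<Rightarrow> real"
      assume g: "continuous_on UNIV g" "bounded (range g)"
      then obtain c where c: "\<And>x. \<bar>g x\<bar> \<le> c"
        by (auto simp: bounded_iff)
      have gm: "g \<in> borel_measurable \<nu>"
        using borel_measurable_continuous_onI[OF g(1)] measurable_cong_sets[OF assms(6) refl] by auto
      define I where "I = (LINT x|\<nu>. \<bar>h x\<bar>)"
      have I: "0 \<le> I"
        by (simp add: I_def)
      show "(\<lambda>n. signed_integral (\<Psi> n l) g) \<longlonglongrightarrow> signed_integral (\<Phi> l) g"
      proof (rule LIMSEQ_I)
        fix r :: real assume r: "0 < r"
        \<comment> \<open>Adding 1 avoids division by 0 when \<open>I\<close> is 0 and makes
          \<open>e * I < r\<close> strict.\<close>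
        define e where "e = r / (I + 1)"
        have e: "0 < e" "e * I < r"
          using r I by (auto simp: e_def field_simps)
        have "uniformly_continuous_on K g"
          using K g(1) compact_uniformly_continuous continuous_on_subset by blast
        then obtain d where d: "0 < d" "\<And>x y. x \<in> K \<Longrightarrow> y \<in> K \<Longrightarrow> dist x y < d \<Longrightarrow> dist (g x) (g y) < e"
          using e(1) unfolding uniformly_continuous_on_def by metis
        obtain n0 where n0: "1 / real (Suc n0) < d"
          using d(1) nat_approx_posE by blast
        have "norm (signed_integral (\<Psi> n l) g - signed_integral (\<Phi> l) g) < r" if n: "n \<ge> n0" for n
        proof -
          have "\<bar>g x - g y\<bar> \<le> e" if C: "C \<in> P n" "measure \<nu> C \<noteq> 0" "x \<in> C" "y \<in> C" for C x y
          proof -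
            \<comment> \<open>The complement of the support is null, so a cell of positive measure
              meets \<open>K\<close>; the choice of the partition then puts the whole cell inside
              \<open>K\<close>, where \<open>g\<close> is uniformly continuous.\<close>
            have "\<not> C \<subseteq> - K"
            proof
              assume "C \<subseteq> - K"
              then have "emeasure \<nu> C \<le> emeasure \<nu> (- K)"
                using K assms(6) by (intro emeasure_mono) (simp_all add: borel_comp borel_compact)
              then show False
                using C(2) emeasure_Compl_support[OF assms(6)] by (simp add: K_def measure_def)
            qed
            then obtain z where z: "z \<in> C" "z \<in> K"
              by blast
            have "1 / real (Suc n) \<le> 1 / real (Suc n0)"
              using n by (simp add: frac_le)
            then have "x \<in> K" "y \<in> K" "dist x y < d"
              using fine[OF C(1) z(1) C(3) z(2)] fine[OF C(1) z(1) C(4) z(2)] 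
                fine[OF C(1) C(3) C(4)] n0 by auto
            then show ?thesis
              using d(2)[of x y] by (simp add: dist_real_def)
          qed
          then have "\<bar>signed_integral (\<Psi> n l) g - signed_integral (\<Phi> l) g\<bar> \<le> e * I"
            unfolding \<Psi>_def h(2) I_def
            by (intro signed_integral_cell_average_diff[OF assms(6,7) P h(1) gm c]) auto
          then show ?thesis
            using e(2) by simp
        qed
        then show "\<exists>n0. \<forall>n\<ge>n0. norm (signed_integral (\<Psi> n l) g - signed_integral (\<Phi> l) g) < r"
          by blast
      qed
    qed
  qed
qed

end
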